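(* Let $Q$ be a quandle and let $x\in Q$ be such that $|L_x|$ (the order of the permutation $L_x$) and $|\mathrm{Dis}(Q)|$ are finite and coprime. Then: (i) the orbit of $[x]_{\lambda_Q}$ (i.e. of $L_x$, identifying the class of $y$ in $Q/\lambda_Q$ with $L_y$) in $Q/\lambda_Q$ is superconnected. (ii) If $Q$ is connected then $Q/\lambda_Q$ is superconnected.
   Context: A quandle is a set $Q$ with two binary operations $*,\backslash$ such that $x*(x\backslash y)=y=x\backslash(x*y)$, $x*x=x$ and $x*(y*z)=(x*y)*(x*z)$ for all $x,y,z$; each $L_x:y\mapsto x*y$ is a permutation. $\mathrm{LMlt}(Q)=\langle L_x : x\in Q\rangle$, and the displacement group is $\mathrm{Dis}(Q)=\langle hL_xL_y^{-1}h^{-1} : x,y\in Q,\ h\in\mathrm{LMlt}(Q)\rangle$. The orbit of $x$ is its orbit under $\mathrm{LMlt}(Q)$; it is a subalgebra. A subalgebra is a nonempty subset closed under $*$ and $\backslash$. $Q$ is connected if $\mathrm{LMlt}(Q)$ is transitive on $Q$, and superconnected if every subalgebra of $Q$ is connected. The Cayley kernel $\lambda_Q$ is defined by $x\,\lambda_Q\,y$ iff $L_x=L_y$; for a quandle it is a congruence, and $Q/\lambda_Q$ is the quotient quandle with $[x]*[y]=[x*y]$. *)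

theory Defs
  imports "HOL-Algebra.Algebra"
begin

record 'a quandle = "'a partial_object" +
  star :: "'a \<Rightarrow> 'a \<Rightarrow> 'a"  (infixl \<open>\<star>\<index>\<close> 70)
  ldiv :: "'a \<Rightarrow> 'a \<Rightarrow> 'a"  (infixl \<open>\<setminus>\<index>\<close> 70)

locale quandle =
  fixes Q (structure)
  assumes star_closed [simp, intro]:
      "\<lbrakk>x \<in> carrier Q; y \<in> carrier Q\<rbrakk> \<Longrightarrow> x \<star> y \<in> carrier Q"
    and ldiv_closed [simp, intro]:
      "\<lbrakk>x \<in> carrier Q; y \<in> carrier Q\<rbrakk> \<Longrightarrow> x \<setminus> y \<in> carrier Q"
    and star_ldiv [simp]:
      "\<lbrakk>x \<in> carrier Q; y \<in> carrier Q\<rbrakk> \<Longrightarrow> x \<star> (x \<setminus> y) = y"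
    and ldiv_star [simp]:
      "\<lbrakk>x \<in> carrier Q; y \<in> carrier Q\<rbrakk> \<Longrightarrow> x \<setminus> (x \<star> y) = y"
    and star_idem [simp]:
      "x \<in> carrier Q \<Longrightarrow> x \<star> x = x"
    and star_distrib:
      "\<lbrakk>x \<in> carrier Q; y \<in> carrier Q; z \<in> carrier Q\<rbrakk>
        \<Longrightarrow> x \<star> (y \<star> z) = (x \<star> y) \<star> (x \<star> z)"

text \<open>Left translations are cut off to the carrier, so that they are elements of the library's
  symmetric group \<^const>\<open>BijGroup\<close> and can be compared with \<open>=\<close>.\<close>

definition left_trans :: "('a, 'b) quandle_scheme \<Rightarrow> 'a \<Rightarrow> 'a \<Rightarrow> 'a" where
  "left_trans Q x = (\<lambda>y\<in>carrier Q. x \<star>\<^bsub>Q\<^esub> y)"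

definition LMlt :: "('a, 'b) quandle_scheme \<Rightarrow> ('a \<Rightarrow> 'a) set" where
  "LMlt Q = generate (BijGroup (carrier Q)) (left_trans Q ` carrier Q)"

definition Dis :: "('a, 'b) quandle_scheme \<Rightarrow> ('a \<Rightarrow> 'a) set" where
  "Dis Q = (let G = BijGroup (carrier Q) in
     generate G
       {h \<otimes>\<^bsub>G\<^esub> left_trans Q x \<otimes>\<^bsub>G\<^esub> inv\<^bsub>G\<^esub> (left_trans Q y) \<otimes>\<^bsub>G\<^esub> inv\<^bsub>G\<^esub> h | h x y.
          h \<in> LMlt Q \<and> x \<in> carrier Q \<and> y \<in> carrier Q})"

definition quandle_orbit :: "('a, 'b) quandle_scheme \<Rightarrow> 'a \<Rightarrow> 'a set" where
  "quandle_orbit Q x = {h x | h. h \<in> LMlt Q}"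

definition subalgebra_of :: "'a set \<Rightarrow> ('a, 'b) quandle_scheme \<Rightarrow> bool" where
  "subalgebra_of S Q \<longleftrightarrow> S \<noteq> {} \<and> S \<subseteq> carrier Q \<and>
     (\<forall>x\<in>S. \<forall>y\<in>S. x \<star>\<^bsub>Q\<^esub> y \<in> S \<and> x \<setminus>\<^bsub>Q\<^esub> y \<in> S)"

definition connected_quandle :: "('a, 'b) quandle_scheme \<Rightarrow> bool" where
  "connected_quandle Q \<longleftrightarrow>
     (\<forall>x\<in>carrier Q. \<forall>y\<in>carrier Q. \<exists>h\<in>LMlt Q. h x = y)"

text \<open>A subalgebra \<open>S\<close> is itself the quandle \<open>Q\<lparr>carrier := S\<rparr>\<close>; its connectedness refers to its own
  left multiplication group, generated by the \<open>L\<^sub>s\<close> with \<open>s \<in> S\<close>, restricted to \<open>S\<close>.\<close>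

definition superconnected_quandle :: "('a, 'b) quandle_scheme \<Rightarrow> bool" where
  "superconnected_quandle Q \<longleftrightarrow>
     (\<forall>S. subalgebra_of S Q \<longrightarrow> connected_quandle (Q\<lparr>carrier := S\<rparr>))"

definition cayley_kernel :: "('a, 'b) quandle_scheme \<Rightarrow> ('a \<times> 'a) set" where
  "cayley_kernel Q =
     {(x, y). x \<in> carrier Q \<and> y \<in> carrier Q \<and> left_trans Q x = left_trans Q y}"

text \<open>For a congruence \<open>\<theta>\<close>, the unions below are unions of copies of one and the same class;
  see \<open>quot_star\<close> and \<open>quot_ldiv\<close> for \<open>\<theta>\<close> the Cayley kernel.\<close>

definition quot_quandle ::
    "('a, 'b) quandle_scheme \<Rightarrow> ('a \<times> 'a) set \<Rightarrow> 'a set quandle" where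
  "quot_quandle Q \<theta> =
     \<lparr>carrier = carrier Q // \<theta>,
      star = (\<lambda>A B. \<Union>a\<in>A. \<Union>b\<in>B. \<theta> `` {a \<star>\<^bsub>Q\<^esub> b}),
      ldiv = (\<lambda>A B. \<Union>a\<in>A. \<Union>b\<in>B. \<theta> `` {a \<setminus>\<^bsub>Q\<^esub> b})\<rparr>"

context quandle
begin

lemma left_trans_Bij:
  assumes "x \<in> carrier Q"
  shows "left_trans Q x \<in> Bij (carrier Q)"
proof -
  have "bij_betw (left_trans Q x) (carrier Q) (carrier Q)"
    by (rule bij_betw_byWitness [where f' = "\<lambda>y. x \<setminus> y"])
       (use assms in \<open>auto simp: left_trans_def\<close>)
  then show ?thesis
    by (simp add: Bij_def left_trans_def)
qed

lemma quandle_subalgebra: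
  assumes "subalgebra_of S Q"
  shows "quandle (Q\<lparr>carrier := S\<rparr>)"
proof -
  have "S \<subseteq> carrier Q" and "\<And>x y. x \<in> S \<Longrightarrow> y \<in> S \<Longrightarrow> x \<star> y \<in> S \<and> x \<setminus> y \<in> S"
    using assms by (auto simp: subalgebra_of_def)
  then show ?thesis
    by unfold_locales (auto simp: subset_iff intro: star_distrib)
qed

lemma LMlt_Bij: "LMlt Q \<subseteq> Bij (carrier Q)"
proof -
  interpret group "BijGroup (carrier Q)" by (rule group_BijGroup)
  have "left_trans Q ` carrier Q \<subseteq> carrier (BijGroup (carrier Q))"
    using left_trans_Bij by (auto simp: BijGroup_def)
  from generate_incl [OF this] show ?thesis
    by (simp add: LMlt_def BijGroup_def)
qed

lemma left_trans_LMlt: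
  assumes "x \<in> carrier Q" "h \<in> LMlt Q" "y \<in> carrier Q"
  shows "\<exists>k\<in>LMlt Q. k y = x \<star> h y" "\<exists>k\<in>LMlt Q. k y = x \<setminus> h y"
proof -
  let ?G = "BijGroup (carrier Q)" and ?L = "left_trans Q x"
  have h: "h \<in> Bij (carrier Q)" using assms LMlt_Bij by auto
  then have hy: "h y \<in> carrier Q" using assms Bij_imp_funcset by fastforce
  have L: "?L \<in> Bij (carrier Q)" using left_trans_Bij assms by auto
  have app: "(g \<otimes>\<^bsub>?G\<^esub> f) z = g (f z)"
    if "g \<in> Bij (carrier Q)" "f \<in> Bij (carrier Q)" "z \<in> carrier Q" for g f z
    using that by (simp add: BijGroup_def compose_def)
  have "?L \<otimes>\<^bsub>?G\<^esub> h \<in> LMlt Q"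
    using assms unfolding LMlt_def by (intro generate.eng [OF generate.incl]) auto
  moreover have "(?L \<otimes>\<^bsub>?G\<^esub> h) y = x \<star> h y"
    using h L hy assms by (simp add: app) (simp add: left_trans_def)
  ultimately show "\<exists>k\<in>LMlt Q. k y = x \<star> h y" by blast
  have iL: "inv\<^bsub>?G\<^esub> ?L = (\<lambda>z\<in>carrier Q. inv_into (carrier Q) ?L z)"
    using L by (rule inv_BijGroup)
  then have iB: "inv\<^bsub>?G\<^esub> ?L \<in> Bij (carrier Q)"
    using L restrict_inv_into_Bij by metis
  have inj: "inj_on ?L (carrier Q)" using L by (simp add: Bij_def bij_betw_def)
  have "inv\<^bsub>?G\<^esub> ?L \<otimes>\<^bsub>?G\<^esub> h \<in> LMlt Q"
    using assms unfolding LMlt_def by (intro generate.eng [OF generate.inv]) auto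
  moreover have "inv_into (carrier Q) ?L (h y) = x \<setminus> h y"
    using hy assms by (intro inv_into_f_eq [OF inj]) (auto simp: left_trans_def)
  then have "(inv\<^bsub>?G\<^esub> ?L \<otimes>\<^bsub>?G\<^esub> h) y = x \<setminus> h y"
    using h hy assms app [OF iB h] by (simp add: iL)
  ultimately show "\<exists>k\<in>LMlt Q. k y = x \<setminus> h y" by blast
qed

lemma subalgebra_orbit:
  assumes "x \<in> carrier Q"
  shows "subalgebra_of (quandle_orbit Q x) Q" "x \<in> quandle_orbit Q x"
proof -
  have "(\<lambda>y\<in>carrier Q. y) \<in> LMlt Q"
    using generate.one [of "BijGroup (carrier Q)"] by (simp add: LMlt_def BijGroup_def)
  then show x: "x \<in> quandle_orbit Q x"
    using assms unfolding quandle_orbit_def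
    by (intro CollectI exI [of _ "\<lambda>y\<in>carrier Q. y"]) simp
  have sub: "quandle_orbit Q x \<subseteq> carrier Q"
    using LMlt_Bij Bij_imp_funcset assms by (fastforce simp: quandle_orbit_def)
  have "u \<star> v \<in> quandle_orbit Q x \<and> u \<setminus> v \<in> quandle_orbit Q x"
    if uv: "u \<in> quandle_orbit Q x" "v \<in> quandle_orbit Q x" for u v
  proof -
    obtain h where h: "h \<in> LMlt Q" "v = h x" using uv by (auto simp: quandle_orbit_def)
    have "u \<in> carrier Q" using uv sub by auto
    from left_trans_LMlt [OF this h(1) assms] show ?thesis
      unfolding quandle_orbit_def h(2) by (metis (mono_tags, lifting) mem_Collect_eq)
  qed
  then show "subalgebra_of (quandle_orbit Q x) Q"
    using x sub by (auto simp: subalgebra_of_def)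
qed

lemma equiv_cayley_kernel: "equiv (carrier Q) (cayley_kernel Q)"
  by (rule equivI) (auto simp: cayley_kernel_def refl_on_def sym_def trans_def)

lemma cayley_kernel_iff:
  "(x, y) \<in> cayley_kernel Q \<longleftrightarrow>
     x \<in> carrier Q \<and> y \<in> carrier Q \<and> (\<forall>z\<in>carrier Q. x \<star> z = y \<star> z)"
  unfolding cayley_kernel_def left_trans_def by (auto simp: restrict_def fun_eq_iff)

lemma cayley_kernel_star:
  assumes "(x, x') \<in> cayley_kernel Q" "(y, y') \<in> cayley_kernel Q"
  shows "(x \<star> y, x' \<star> y') \<in> cayley_kernel Q"
proof -
  have *: "x \<in> carrier Q" "x' \<in> carrier Q" "y \<in> carrier Q" "y' \<in> carrier Q"
    and x: "\<And>z. z \<in> carrier Q \<Longrightarrow> x \<star> z = x' \<star> z"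
    and y: "\<And>z. z \<in> carrier Q \<Longrightarrow> y \<star> z = y' \<star> z"
    using assms by (auto simp: cayley_kernel_iff)
  have "(x \<star> y) \<star> z = (x' \<star> y') \<star> z" if z: "z \<in> carrier Q" for z
  proof -
    have "(x \<star> y) \<star> z = x \<star> (y \<star> (x \<setminus> z))"
      using star_distrib [of x y "x \<setminus> z"] * z by simp
    also have "\<dots> = x' \<star> (y' \<star> (x \<setminus> z))" using x y * z by simp
    also have "\<dots> = (x' \<star> y') \<star> (x' \<star> (x \<setminus> z))"
      using star_distrib [of x' y' "x \<setminus> z"] * z by simp
    also have "x' \<star> (x \<setminus> z) = z" using x [of "x \<setminus> z"] * z by simp
    finally show ?thesis .
  qed
  then show ?thesis using * by (simp add: cayley_kernel_iff)
qed

lemma cayley_kernel_ldiv: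
  assumes "(x, x') \<in> cayley_kernel Q" "(y, y') \<in> cayley_kernel Q"
  shows "(x \<setminus> y, x' \<setminus> y') \<in> cayley_kernel Q"
proof -
  have *: "x \<in> carrier Q" "x' \<in> carrier Q" "y \<in> carrier Q" "y' \<in> carrier Q"
    and x: "\<And>z. z \<in> carrier Q \<Longrightarrow> x \<star> z = x' \<star> z"
    and y: "\<And>z. z \<in> carrier Q \<Longrightarrow> y \<star> z = y' \<star> z"
    using assms by (auto simp: cayley_kernel_iff)
  have conj: "(u \<setminus> v) \<star> z = u \<setminus> (v \<star> (u \<star> z))"
    if "u \<in> carrier Q" "v \<in> carrier Q" "z \<in> carrier Q" for u v z
  proof -
    have "u \<star> ((u \<setminus> v) \<star> z) = v \<star> (u \<star> z)"
      using star_distrib [of u "u \<setminus> v" z] that by simp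
    then show ?thesis using that by (metis ldiv_star ldiv_closed star_closed)
  qed
  have xd: "x \<setminus> z = x' \<setminus> z" if "z \<in> carrier Q" for z
    using x [of "x \<setminus> z"] * that by (metis ldiv_star ldiv_closed star_ldiv)
  show ?thesis using * x y xd by (simp add: cayley_kernel_iff conj)
qed

lemma
  assumes "x \<in> carrier Q" "y \<in> carrier Q"
  shows quot_star: "cayley_kernel Q `` {x} \<star>\<^bsub>quot_quandle Q (cayley_kernel Q)\<^esub> cayley_kernel Q `` {y}
           = cayley_kernel Q `` {x \<star> y}"
    and quot_ldiv: "cayley_kernel Q `` {x} \<setminus>\<^bsub>quot_quandle Q (cayley_kernel Q)\<^esub> cayley_kernel Q `` {y}
           = cayley_kernel Q `` {x \<setminus> y}"
proof -
  note eq = equiv_class_eq [OF equiv_cayley_kernel]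
  have self: "x \<in> cayley_kernel Q `` {x}" "y \<in> cayley_kernel Q `` {y}"
    using assms by (auto simp: cayley_kernel_iff)
  have s: "cayley_kernel Q `` {a \<star> b} = cayley_kernel Q `` {x \<star> y}"
    "cayley_kernel Q `` {a \<setminus> b} = cayley_kernel Q `` {x \<setminus> y}"
    if "a \<in> cayley_kernel Q `` {x}" "b \<in> cayley_kernel Q `` {y}" for a b
    using that eq [OF cayley_kernel_star] eq [OF cayley_kernel_ldiv] by auto
  show "cayley_kernel Q `` {x} \<star>\<^bsub>quot_quandle Q (cayley_kernel Q)\<^esub> cayley_kernel Q `` {y}
      = cayley_kernel Q `` {x \<star> y}"
    unfolding quot_quandle_def quandle.simps using self s(1) by blast
  show "cayley_kernel Q `` {x} \<setminus>\<^bsub>quot_quandle Q (cayley_kernel Q)\<^esub> cayley_kernel Q `` {y}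
      = cayley_kernel Q `` {x \<setminus> y}"
    unfolding quot_quandle_def quandle.simps using self s(2) by blast
qed

lemma quandle_quot: "quandle (quot_quandle Q (cayley_kernel Q))"
proof -
  have carr: "carrier (quot_quandle Q (cayley_kernel Q)) =
      (\<lambda>x. cayley_kernel Q `` {x}) ` carrier Q"
    by (auto simp: quot_quandle_def quotient_def)
  show ?thesis
    by unfold_locales (auto simp: carr quot_star quot_ldiv star_distrib [symmetric])
qed

end

end

theory Submission
  imports Defs
begin

text \<open>
  Identify the class of \<open>y\<close> modulo the Cayley kernel with the permutation \<open>L\<^sub>y\<close>, so that the quotient
  quandle becomes a set of permutations under conjugation. The orbit of \<open>L\<^sub>x\<close> then consists of
  conjugates of \<open>L\<^sub>x\<close>; they all satisfy \<open>a\<^sup>n = 1\<close> for \<open>n = |L\<^sub>x|\<close>, and they all lie in one coset of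
  \<open>Dis(Q)\<close>. Let \<open>S\<close> be a subalgebra of this orbit, \<open>H\<close> the group generated by the elements of \<open>S\<close>, and
  \<open>K = H \<inter> Dis(Q)\<close>, a finite normal subgroup of \<open>H\<close> of order prime to \<open>n\<close>. Two elements \<open>a, b\<close> of \<open>S\<close>
  generate subgroups that complement \<open>K\<close> in \<open>K\<langle>a\<rangle>\<close>, and the conjugacy part of the Schur--Zassenhaus
  theorem, for a cyclic complement, says that some \<open>k \<in> K\<close> conjugates \<open>a\<close> to \<open>b\<close>. As \<open>k\<close> is a product
  of elements of \<open>S\<close> and their inverses, \<open>a\<close> and \<open>b\<close> are in the same orbit of the quandle \<open>S\<close>.

  The required case of Schur--Zassenhaus is \<open>coprime_exponent_intertwiner\<close>. It has a short proof by
  fixed points: \<open>b = k a k\<^sup>-\<^sup>1\<close> means that \<open>k\<close> is fixed by the permutation \<open>\<phi>: k \<mapsto> b k a\<^sup>-\<^sup>1\<close> of \<open>K\<close>, and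
  \<open>\<phi>\<^sup>n = id\<close>. If \<open>p\<close> is a prime factor of \<open>n\<close>, then by induction \<open>\<phi>\<^sup>p\<close> has a fixed point; its fixed points
  form a coset of the centralizer of \<open>a\<^sup>p\<close> in \<open>K\<close>, so their number divides \<open>|K|\<close> and is prime to \<open>p\<close>.
  As \<open>\<phi>\<close> permutes these points with period \<open>p\<close>, it fixes one of them.

  Statement (ii) follows from (i): if \<open>Q\<close> is connected, the orbit of the class of \<open>x\<close> is the whole quotient.
\<close>

section \<open>Fixed points of periodic maps\<close>

text \<open>If no point of \<open>F\<close> is fixed, every orbit of \<open>\<phi>\<close> has exactly \<open>p\<close> elements, and the orbits partition
  \<open>F\<close>.\<close>

lemma fixed_point_of_prime_period:
  fixes \<phi> :: "'a \<Rightarrow> 'a"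
  assumes fin: "finite F" and maps: "\<And>u. u \<in> F \<Longrightarrow> \<phi> u \<in> F"
    and period: "\<And>u. u \<in> F \<Longrightarrow> (\<phi> ^^ p) u = u"
    and p: "Factorial_Ring.prime p" and ndvd: "\<not> p dvd card F"
  obtains u where "u \<in> F" "\<phi> u = u"
proof (rule ccontr)
  assume "\<not> thesis"
  with that have nofix: "\<phi> u \<noteq> u" if "u \<in> F" for u
    using \<open>u \<in> F\<close> by blast
  have p0: "0 < p" using p by (simp add: prime_gt_0_nat)
  have it: "(\<phi> ^^ i) u \<in> F" if "u \<in> F" for i u
    using that by (induction i) (auto intro: maps)
  have mult: "(\<phi> ^^ (d * i)) u = u" if "(\<phi> ^^ d) u = u" for d i u
    using that by (induction i) (auto simp: funpow_add)
  have modp: "(\<phi> ^^ i) u = (\<phi> ^^ (i mod p)) u" if "u \<in> F" for i u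
  proof -
    have "(\<phi> ^^ i) u = (\<phi> ^^ (i mod p + p * (i div p))) u" by simp
    also have "\<dots> = (\<phi> ^^ (i mod p)) ((\<phi> ^^ (p * (i div p))) u)"
      by (simp only: funpow_add comp_apply)
    also have "\<dots> = (\<phi> ^^ (i mod p)) u"
      by (simp only: mult [OF period [OF that]])
    finally show ?thesis .
  qed
  define r where "r = {(u, v). u \<in> F \<and> (\<exists>i. v = (\<phi> ^^ i) u)}"
  have "equiv F r"
  proof (rule equivI)
    show "r \<subseteq> F \<times> F" by (auto simp: r_def it)
    show "refl_on F r"
      by (auto simp: refl_on_def r_def it intro: exI [of _ 0])
    show "sym r"
    proof (rule symI)
      fix u v assume "(u, v) \<in> r"
      then obtain i where u: "u \<in> F" and v: "v = (\<phi> ^^ i) u" by (auto simp: r_def)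
      \<comment> \<open>Iterating \<open>p * i - i\<close> more times completes \<open>i\<close> full periods.\<close>
      have "(\<phi> ^^ (p * i - i)) v = (\<phi> ^^ (p * i - i + i)) u"
        by (simp only: v funpow_add comp_apply)
      also have "p * i - i + i = p * i" using p0 by simp
      also have "(\<phi> ^^ (p * i)) u = u" by (rule mult [OF period [OF u]])
      finally show "(v, u) \<in> r" using u v it by (auto simp: r_def intro: exI [of _ "p * i - i"])
    qed
    show "trans r"
      by (auto simp: trans_def r_def it) (metis comp_apply funpow_add)
  qed
  moreover have "p dvd card c" if "c \<in> F // r" for c
  proof -
    from that obtain u where u: "u \<in> F" and c: "c = r `` {u}" by (auto simp: quotient_def)
    have "c = (\<lambda>i. (\<phi> ^^ i) u) ` {..<p}"
      using u p0 modp [OF u] by (auto simp: c r_def image_iff) (metis lessThan_iff mod_less_divisor)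
    moreover have "inj_on (\<lambda>i. (\<phi> ^^ i) u) {..<p}"
    proof (rule linorder_inj_onI)
      fix i j assume ij: "i < j" "i \<in> {..<p}" "j \<in> {..<p}"
      show "(\<phi> ^^ i) u \<noteq> (\<phi> ^^ j) u"
      proof
        assume eq: "(\<phi> ^^ i) u = (\<phi> ^^ j) u"
        define w where "w = (\<phi> ^^ i) u"
        have w: "w \<in> F" using it u by (simp add: w_def)
        have "(\<phi> ^^ (j - i)) w = (\<phi> ^^ (j - i + i)) u"
          by (simp only: w_def funpow_add comp_apply)
        then have d: "(\<phi> ^^ (j - i)) w = w"
          using eq ij by (simp add: w_def)
        \<comment> \<open>\<open>w\<close> has the coprime periods \<open>j - i\<close> and \<open>p\<close>, hence period 1.\<close>
        have "\<not> p dvd j - i" using ij by (auto dest: dvd_imp_le)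
        then have "gcd (j - i) p = 1"
          using prime_imp_coprime [OF p] by (metis coprime_commute coprime_imp_gcd_eq_1)
        then obtain k l where kl: "(j - i) * k = p * l + 1"
          using bezout_nat [of "j - i" p] ij by auto
        have "w = (\<phi> ^^ (p * l + 1)) w" using mult [OF d, of k] by (simp only: kl)
        also have "\<dots> = (\<phi> ^^ (1 + p * l)) w" by (simp only: add.commute)
        also have "\<dots> = \<phi> ((\<phi> ^^ (p * l)) w)" by simp
        also have "\<dots> = \<phi> w" by (simp only: mult [OF period [OF w]])
        finally show False using nofix [OF w] by simp
      qed
    qed auto
    ultimately show ?thesis by (simp add: card_image)
  qed
  ultimately have "p dvd card F"
    by (rule equiv_imp_dvd_card [OF fin])
  with ndvd show False by simp
qed

section \<open>Conjugacy of elements of coprime order\<close>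

context group
begin

lemma funpow_twisted_translation:
  assumes "a \<in> carrier G" "b \<in> carrier G" "k \<in> carrier G"
  shows "((\<lambda>k. b \<otimes> k \<otimes> inv a) ^^ j) k = b [^] j \<otimes> k \<otimes> inv (a [^] j)"
proof (induction j)
  case (Suc j)
  have "((\<lambda>k. b \<otimes> k \<otimes> inv a) ^^ Suc j) k = b \<otimes> (b [^] j \<otimes> k \<otimes> inv (a [^] j)) \<otimes> inv a"
    using Suc by simp
  also have "\<dots> = (b \<otimes> b [^] j) \<otimes> k \<otimes> inv (a \<otimes> a [^] j)"
    using assms by (simp add: m_assoc inv_mult_group)
  finally show ?case using assms by (simp only: nat_pow_Suc2)
qed (use assms in simp)

text \<open>An element \<open>k\<close> with \<open>b k = k a\<close> is a morphism from \<open>a\<close> to \<open>b\<close>; this lemma and the next provide the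
  groupoid structure. When all the elements related are equal to \<open>a\<close>, they say that centralizers are subgroups.\<close>

lemma intertwine_mult:
  assumes "a \<in> carrier G" "b \<in> carrier G" "d \<in> carrier G" "k \<in> carrier G" "c \<in> carrier G"
    and "b \<otimes> k = k \<otimes> a" "a \<otimes> c = c \<otimes> d"
  shows "b \<otimes> (k \<otimes> c) = k \<otimes> c \<otimes> d"
proof -
  have "b \<otimes> (k \<otimes> c) = k \<otimes> (a \<otimes> c)"
    using assms(1-6) by (simp add: m_assoc [symmetric])
  then show ?thesis using assms by (simp add: m_assoc)
qed

lemma intertwine_inv:
  assumes "a \<in> carrier G" "b \<in> carrier G" "k \<in> carrier G"
    and "b \<otimes> k = k \<otimes> a"
  shows "a \<otimes> inv k = inv k \<otimes> b"
proof -
  have "inv k \<otimes> b = inv k \<otimes> (b \<otimes> k) \<otimes> inv k"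
    using assms(1-3) by (simp add: m_assoc)
  also have "\<dots> = a \<otimes> inv k"
    unfolding assms(4) using assms(1-3) by (simp add: m_assoc [symmetric])
  finally show ?thesis by simp
qed

lemma card_subgroup_dvd:
  assumes "subgroup I G" "subgroup J G" "I \<subseteq> J"
  shows "card I dvd card J"
proof -
  interpret J: group "G\<lparr>carrier := J\<rparr>" by (rule subgroup_imp_group [OF assms(2)])
  have "order (G\<lparr>carrier := J\<rparr>) = card J" by (simp add: order_def)
  then show ?thesis
    using J.lagrange [OF subgroup_incl [OF assms]] by (metis dvd_triv_right)
qed

text \<open>The set in question is the coset \<open>k\<^sub>0 C\<close> of the centralizer \<open>C\<close> of \<open>a\<close> in \<open>K\<close>.\<close>

lemma card_intertwiners_dvd:
  assumes K: "subgroup K G" "finite K" and ab: "a \<in> carrier G" "b \<in> carrier G"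
    and k0: "k0 \<in> K" "b \<otimes> k0 = k0 \<otimes> a"
  shows "card {k \<in> K. b \<otimes> k = k \<otimes> a} dvd card K"
proof -
  interpret K: subgroup K G by fact
  define C where "C = {k \<in> K. a \<otimes> k = k \<otimes> a}"
  have "subgroup C G"
  proof (rule subgroupI)
    show "C \<subseteq> carrier G" by (auto simp: C_def)
    show "C \<noteq> {}" using ab K.one_closed by (auto simp: C_def intro!: exI [of _ \<one>])
    fix c assume c: "c \<in> C"
    then show "inv c \<in> C" using ab intertwine_inv [of a a c] by (simp add: C_def)
    fix d assume "d \<in> C"
    with c show "c \<otimes> d \<in> C" using ab intertwine_mult [of a a a c d] by (simp add: C_def)
  qed
  then have "card C dvd card K"
    using K(1) by (rule card_subgroup_dvd) (auto simp: C_def)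
  moreover have "bij_betw (\<lambda>c. k0 \<otimes> c) C {k \<in> K. b \<otimes> k = k \<otimes> a}"
  proof (rule bij_betw_byWitness [where f' = "\<lambda>k. inv k0 \<otimes> k"])
    have *: "k0 \<in> carrier G" using k0 by simp
    show "\<forall>c\<in>C. inv k0 \<otimes> (k0 \<otimes> c) = c"
      using * by (auto simp: C_def m_assoc [symmetric])
    show "\<forall>k\<in>{k \<in> K. b \<otimes> k = k \<otimes> a}. k0 \<otimes> (inv k0 \<otimes> k) = k"
      using * by (auto simp: m_assoc [symmetric])
    show "(\<lambda>c. k0 \<otimes> c) ` C \<subseteq> {k \<in> K. b \<otimes> k = k \<otimes> a}"
      using * k0 ab intertwine_mult [of a b a k0] by (auto simp: C_def)
    have "a \<otimes> (inv k0 \<otimes> k) = inv k0 \<otimes> k \<otimes> a" if "k \<in> K" "b \<otimes> k = k \<otimes> a" for k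
      using that ab * intertwine_inv [OF ab * k0(2)] by (intro intertwine_mult [of b]) auto
    then show "(\<lambda>k. inv k0 \<otimes> k) ` {k \<in> K. b \<otimes> k = k \<otimes> a} \<subseteq> C"
      using k0 by (auto simp: C_def)
  qed
  ultimately show ?thesis by (metis bij_betw_same_card)
qed

text \<open>This is the conjugacy part of the Schur--Zassenhaus theorem for a cyclic complement. If \<open>a\<close>
  normalizes \<open>K\<close>, then the last hypothesis amounts to \<open>b a\<^sup>-\<^sup>1 \<in> K\<close>. Stating it as invariance of \<open>K\<close> under
  \<open>\<phi>: k \<mapsto> b k a\<^sup>-\<^sup>1\<close> makes it pass immediately to \<open>a\<^sup>p\<close> and \<open>b\<^sup>p\<close>, which induce \<open>\<phi>\<^sup>p\<close>; this allows
  induction on the exponent, one prime factor at a time.\<close>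

lemma coprime_exponent_intertwiner:
  assumes K: "subgroup K G" "finite K"
    and "a \<in> carrier G" "b \<in> carrier G"
    and "0 < n" "coprime n (card K)"
    and "a [^] n = \<one>" "b [^] n = \<one>"
    and "\<And>k. k \<in> K \<Longrightarrow> b \<otimes> k \<otimes> inv a \<in> K"
  shows "\<exists>k\<in>K. b \<otimes> k = k \<otimes> a"
  using assms(3-)
proof (induction n arbitrary: a b rule: less_induct)
  case (less n)
  note ab = less.prems(1,2)
  interpret K: subgroup K G by fact
  let ?\<phi> = "\<lambda>k. b \<otimes> k \<otimes> inv a"
  show ?case
  proof (cases "n = 1")
    case True
    then have "a = \<one>" "b = \<one>" using less.prems by auto
    then show ?thesis by (intro bexI [of _ \<one>]) auto
  next
    case False
    then obtain p where p: "Factorial_Ring.prime p" "p dvd n" using prime_factor_nat by blast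
    then obtain m where n: "n = p * m" by blast
    have m: "0 < m" "m < n" using n prime_gt_1_nat [OF p(1)] \<open>0 < n\<close> by auto
    have pow: "(?\<phi> ^^ p) k = b [^] p \<otimes> k \<otimes> inv (a [^] p)" if "k \<in> K" for k
      using funpow_twisted_translation ab that by simp
    have "(?\<phi> ^^ j) k \<in> K" if "k \<in> K" for j k
      using that by (induction j) (auto intro: less.prems)
    then have "b [^] p \<otimes> k \<otimes> inv (a [^] p) \<in> K" if "k \<in> K" for k
      using pow that by metis
    moreover have "coprime m (card K)" using less.prems(4) by (simp add: n)
    moreover have "(a [^] p) [^] m = \<one>" "(b [^] p) [^] m = \<one>"
      using less.prems by (simp_all add: nat_pow_pow n)
    ultimately obtain k0 where k0: "k0 \<in> K" "b [^] p \<otimes> k0 = k0 \<otimes> a [^] p"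
      using less.IH [OF m(2), of "a [^] p" "b [^] p"] m ab by auto
    define F where "F = {k \<in> K. b [^] p \<otimes> k = k \<otimes> a [^] p}"
    have Fdvd: "card F dvd card K"
      unfolding F_def using card_intertwiners_dvd [OF K _ _ k0] ab by simp
    have "coprime p (card K)" using less.prems(4) by (simp add: n)
    then have ndvd: "\<not> p dvd card F"
      using Fdvd p(1) by (meson coprime_absorb_left dvd_trans not_prime_unit)
    have "?\<phi> k \<in> F" if "k \<in> F" for k
    proof -
      have k: "k \<in> K" "k \<in> carrier G" "b [^] p \<otimes> k = k \<otimes> a [^] p" using that by (auto simp: F_def)
      have c: "b [^] p \<otimes> b = b \<otimes> b [^] p" "a [^] p \<otimes> inv a = inv a \<otimes> a [^] p"
        using ab nat_pow_Suc2 [of _ p] intertwine_inv [of "a [^] p" "a [^] p" a] by auto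
      have "b [^] p \<otimes> (b \<otimes> k) = b \<otimes> k \<otimes> a [^] p"
        using ab k c(1) by (intro intertwine_mult [of "b [^] p" "b [^] p" "a [^] p" b k]) auto
      then have "b [^] p \<otimes> ?\<phi> k = ?\<phi> k \<otimes> a [^] p"
        using ab k c(2) by (intro intertwine_mult [of "a [^] p" "b [^] p" "a [^] p" "b \<otimes> k" "inv a"]) auto
      then show ?thesis using less.prems(7) k by (simp add: F_def)
    qed
    moreover have "(?\<phi> ^^ p) k = k" if "k \<in> F" for k
    proof -
      have k: "k \<in> K" "b [^] p \<otimes> k = k \<otimes> a [^] p" using that by (auto simp: F_def)
      show ?thesis unfolding pow [OF k(1)] k(2) using ab k(1) by (simp add: m_assoc)
    qed
    moreover have "finite F" using K by (simp add: F_def)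
    ultimately obtain k where k: "k \<in> F" "?\<phi> k = k"
      using fixed_point_of_prime_period [of F ?\<phi> p] p(1) ndvd by metis
    have "b \<otimes> k = k \<otimes> a"
      using k ab inv_solve_right [of k "b \<otimes> k" a] by (auto simp: F_def)
    with k show ?thesis by (auto simp: F_def)
  qed
qed

lemma generate_conj_closed:
  assumes A: "A \<subseteq> carrier G" and g: "g \<in> carrier G"
    and closed: "\<And>x. x \<in> A \<Longrightarrow> g \<otimes> x \<otimes> inv g \<in> A"
    and h: "h \<in> generate G A"
  shows "g \<otimes> h \<otimes> inv g \<in> generate G A"
  using h
proof induction
  case one
  then show ?case using g by (simp add: generate.one)
next
  case (incl h)
  then show ?case by (simp add: closed generate.incl)
next
  case (inv h)
  then have "h \<in> carrier G" using A by auto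
  then have "inv (g \<otimes> h \<otimes> inv g) = g \<otimes> inv h \<otimes> inv g"
    using g by (simp add: inv_mult_group m_assoc)
  then show ?case using inv by (metis closed generate.inv)
next
  case (eng h1 h2)
  then have "h1 \<in> carrier G" "h2 \<in> carrier G" using generate_in_carrier [OF A] by auto
  then have "g \<otimes> (h1 \<otimes> h2) \<otimes> inv g = (g \<otimes> h1 \<otimes> inv g) \<otimes> (g \<otimes> h2 \<otimes> inv g)"
    using g by (simp add: m_assoc inv_solve_left)
  then show ?case using eng by (simp add: generate.eng)
qed

end


section \<open>Left multiplication groups\<close>

lemma quandle_orbit_iff: "z \<in> quandle_orbit Q y \<longleftrightarrow> (\<exists>h\<in>LMlt Q. h y = z)"
  by (auto simp: quandle_orbit_def)

context quandle
begin

abbreviation Sym :: "('a \<Rightarrow> 'a) monoid" where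
  "Sym \<equiv> BijGroup (carrier Q)"

lemma mult_Sym_apply:
  assumes "f \<in> carrier Sym" "g \<in> carrier Sym" "y \<in> carrier Q"
  shows "(f \<otimes>\<^bsub>Sym\<^esub> g) y = f (g y)"
  using assms by (simp add: BijGroup_def compose_def)

lemma left_trans_Sym: "T \<subseteq> carrier Q \<Longrightarrow> left_trans Q ` T \<subseteq> carrier Sym"
  using left_trans_Bij by (auto simp: BijGroup_def)

lemma generate_left_trans_Sym:
  assumes "T \<subseteq> carrier Q" "g \<in> generate Sym (left_trans Q ` T)"
  shows "g \<in> carrier Sym"
  using group.generate_in_carrier [OF group_BijGroup left_trans_Sym [OF assms(1)] assms(2)] .

lemma Sym_closed: "g \<in> carrier Sym \<Longrightarrow> y \<in> carrier Q \<Longrightarrow> g y \<in> carrier Q"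
  using Bij_imp_funcset by (fastforce simp: BijGroup_def)

lemma left_trans_apply: "y \<in> carrier Q \<Longrightarrow> left_trans Q s y = s \<star> y"
  by (simp add: left_trans_def)

lemma inv_left_trans_apply:
  assumes "s \<in> carrier Q" "y \<in> carrier Q"
  shows "(inv\<^bsub>Sym\<^esub> (left_trans Q s)) y = s \<setminus> y"
proof -
  have L: "left_trans Q s \<in> Bij (carrier Q)" using left_trans_Bij assms by auto
  then have "inj_on (left_trans Q s) (carrier Q)" by (simp add: Bij_def bij_betw_def)
  then have "inv_into (carrier Q) (left_trans Q s) y = s \<setminus> y"
    using assms by (intro inv_into_f_eq) (auto simp: left_trans_def)
  then show ?thesis using L assms by (simp add: inv_BijGroup)
qed

text \<open>The inverse of \<open>L\<^sub>s\<close> is \<open>y \<mapsto> s \<setminus> y\<close>; thus a set closed under \<open>s \<star> _\<close> and \<open>s \<setminus> _\<close> for \<open>s \<in> T\<close> is stable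
  under the group that the \<open>L\<^sub>s\<close> generate. Below, \<open>R\<close> is an orbit of another quandle, pulled back or
  pushed forward along the projection to the quotient.\<close>

lemma generate_left_trans_invariant:
  assumes T: "T \<subseteq> carrier Q" and g: "g \<in> generate Sym (left_trans Q ` T)"
    and R: "R \<subseteq> carrier Q"
    and closed: "\<And>s y. s \<in> T \<Longrightarrow> y \<in> R \<Longrightarrow> s \<star> y \<in> R \<and> s \<setminus> y \<in> R"
    and y: "y \<in> R"
  shows "g y \<in> R"
  using g y
proof (induction arbitrary: y)
  case one
  then show ?case using R by (auto simp: BijGroup_def)
next
  case (incl h)
  then show ?case using R closed by (auto simp: left_trans_def)
next
  case (inv h)
  then obtain s where "s \<in> T" "h = left_trans Q s" by auto
  moreover have "s \<in> carrier Q" "y \<in> carrier Q" using calculation inv R T by auto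
  ultimately show ?case using inv closed by (simp add: inv_left_trans_apply)
next
  case (eng h1 h2)
  then show ?case
    using R mult_Sym_apply [of h1 h2 y] generate_left_trans_Sym [OF T] by auto
qed

lemma LMlt_automorphism:
  assumes "g \<in> LMlt Q" "u \<in> carrier Q" "v \<in> carrier Q"
  shows "g (u \<star> v) = g u \<star> g v"
  using assms unfolding LMlt_def
proof (induction arbitrary: u v)
  case one
  then show ?case by (simp add: BijGroup_def)
next
  case (incl h)
  then obtain s where s: "s \<in> carrier Q" "h = left_trans Q s" by auto
  then show ?case using incl star_distrib [of s u v] by (simp add: left_trans_apply)
next
  case (inv h)
  then obtain s where s: "s \<in> carrier Q" "h = left_trans Q s" by auto
  have "s \<star> ((s \<setminus> u) \<star> (s \<setminus> v)) = u \<star> v"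
    using s inv star_distrib [of s "s \<setminus> u" "s \<setminus> v"] by simp
  then have "s \<setminus> (u \<star> v) = (s \<setminus> u) \<star> (s \<setminus> v)"
    using s inv ldiv_star [of s "(s \<setminus> u) \<star> (s \<setminus> v)"] by simp
  then show ?case using s inv by (simp add: inv_left_trans_apply)
next
  case (eng h1 h2)
  then have "h1 \<in> carrier Sym" "h2 \<in> carrier Sym" using generate_left_trans_Sym by blast+
  then show ?case using eng by (simp add: mult_Sym_apply Sym_closed)
qed

lemma LMlt_Sym: "g \<in> LMlt Q \<Longrightarrow> g \<in> carrier Sym"
  using LMlt_Bij by (auto simp: BijGroup_def)

text \<open>As \<open>g\<close> is an automorphism, \<open>g L\<^sub>y g\<^sup>-\<^sup>1\<close> is the translation by \<open>g y\<close>; stated without inverses.\<close>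

lemma LMlt_left_trans:
  assumes g: "g \<in> LMlt Q" and y: "y \<in> carrier Q"
  shows "g \<otimes>\<^bsub>Sym\<^esub> left_trans Q y = left_trans Q (g y) \<otimes>\<^bsub>Sym\<^esub> g"
proof (rule extensionalityI)
  have gS: "g \<in> carrier Sym" using LMlt_Sym g .
  have L: "left_trans Q y \<in> carrier Sym" "left_trans Q (g y) \<in> carrier Sym"
    using left_trans_Sym [of "{y, g y}"] y Sym_closed [OF gS] by auto
  interpret S: group Sym by (rule group_BijGroup)
  have ext: "h \<in> extensional (carrier Q)" if "h \<in> carrier Sym" for h
    using that by (simp add: BijGroup_def Bij_def)
  show "g \<otimes>\<^bsub>Sym\<^esub> left_trans Q y \<in> extensional (carrier Q)"
    "left_trans Q (g y) \<otimes>\<^bsub>Sym\<^esub> g \<in> extensional (carrier Q)"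
    using gS L by (auto intro!: ext)
  show "(g \<otimes>\<^bsub>Sym\<^esub> left_trans Q y) v = (left_trans Q (g y) \<otimes>\<^bsub>Sym\<^esub> g) v"
    if "v \<in> carrier Q" for v
    using that gS L g y by (simp add: mult_Sym_apply left_trans_apply Sym_closed LMlt_automorphism)
qed

lemma LMlt_subgroup: "subgroup (LMlt Q) Sym"
  unfolding LMlt_def by (rule group.generate_is_subgroup [OF group_BijGroup left_trans_Sym]) simp

lemma Dis_subgroup: "subgroup (Dis Q) Sym"
proof -
  interpret S: group Sym by (rule group_BijGroup)
  have "left_trans Q u \<in> carrier Sym" if "u \<in> carrier Q" for u
    using that left_trans_Sym [of "{u}"] by simp
  then show ?thesis
    unfolding Dis_def Let_def
    by (intro S.generate_is_subgroup) (auto simp: LMlt_Sym)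
qed

lemma left_trans_quotient_Dis:
  assumes "u \<in> carrier Q" "v \<in> carrier Q"
  shows "left_trans Q u \<otimes>\<^bsub>Sym\<^esub> inv\<^bsub>Sym\<^esub> (left_trans Q v) \<in> Dis Q"
proof -
  interpret S: group Sym by (rule group_BijGroup)
  have L: "left_trans Q u \<in> carrier Sym" "left_trans Q v \<in> carrier Sym"
    using left_trans_Sym [of "{u, v}"] assms by auto
  then have "left_trans Q u \<otimes>\<^bsub>Sym\<^esub> inv\<^bsub>Sym\<^esub> (left_trans Q v) =
      \<one>\<^bsub>Sym\<^esub> \<otimes>\<^bsub>Sym\<^esub> left_trans Q u \<otimes>\<^bsub>Sym\<^esub> inv\<^bsub>Sym\<^esub> (left_trans Q v) \<otimes>\<^bsub>Sym\<^esub> inv\<^bsub>Sym\<^esub> \<one>\<^bsub>Sym\<^esub>"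
    by simp
  moreover have "\<one>\<^bsub>Sym\<^esub> \<in> LMlt Q" unfolding LMlt_def by (rule generate.one)
  ultimately show ?thesis
    unfolding Dis_def Let_def using assms by (intro generate.incl) blast
qed

lemma Dis_conj_closed:
  assumes g: "g \<in> LMlt Q" and d: "d \<in> Dis Q"
  shows "g \<otimes>\<^bsub>Sym\<^esub> d \<otimes>\<^bsub>Sym\<^esub> inv\<^bsub>Sym\<^esub> g \<in> Dis Q"
proof -
  interpret S: group Sym by (rule group_BijGroup)
  have L: "left_trans Q u \<in> carrier Sym" if "u \<in> carrier Q" for u
    using that left_trans_Sym [of "{u}"] by simp
  have gS: "g \<in> carrier Sym" using LMlt_Sym g .
  show ?thesis
    using d unfolding Dis_def Let_def
  proof (rule S.generate_conj_closed [rotated 3])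
    fix c
    assume "c \<in> {h \<otimes>\<^bsub>Sym\<^esub> left_trans Q x \<otimes>\<^bsub>Sym\<^esub> inv\<^bsub>Sym\<^esub> (left_trans Q y) \<otimes>\<^bsub>Sym\<^esub> inv\<^bsub>Sym\<^esub> h | h x y.
      h \<in> LMlt Q \<and> x \<in> carrier Q \<and> y \<in> carrier Q}"
    then obtain h x y where h: "h \<in> LMlt Q" and xy: "x \<in> carrier Q" "y \<in> carrier Q"
      and c: "c = h \<otimes>\<^bsub>Sym\<^esub> left_trans Q x \<otimes>\<^bsub>Sym\<^esub> inv\<^bsub>Sym\<^esub> (left_trans Q y) \<otimes>\<^bsub>Sym\<^esub> inv\<^bsub>Sym\<^esub> h"
      by blast
    have "g \<otimes>\<^bsub>Sym\<^esub> h \<in> LMlt Q" using LMlt_subgroup g h by (rule subgroup.m_closed)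
    moreover have "g \<otimes>\<^bsub>Sym\<^esub> c \<otimes>\<^bsub>Sym\<^esub> inv\<^bsub>Sym\<^esub> g = (g \<otimes>\<^bsub>Sym\<^esub> h) \<otimes>\<^bsub>Sym\<^esub> left_trans Q x
        \<otimes>\<^bsub>Sym\<^esub> inv\<^bsub>Sym\<^esub> (left_trans Q y) \<otimes>\<^bsub>Sym\<^esub> inv\<^bsub>Sym\<^esub> (g \<otimes>\<^bsub>Sym\<^esub> h)"
      using gS LMlt_Sym [OF h] xy L by (simp add: c S.inv_mult_group S.m_assoc)
    ultimately show "g \<otimes>\<^bsub>Sym\<^esub> c \<otimes>\<^bsub>Sym\<^esub> inv\<^bsub>Sym\<^esub> g \<in> {h \<otimes>\<^bsub>Sym\<^esub> left_trans Q x \<otimes>\<^bsub>Sym\<^esub> inv\<^bsub>Sym\<^esub> (left_trans Q y) \<otimes>\<^bsub>Sym\<^esub> inv\<^bsub>Sym\<^esub> h | h x y.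
      h \<in> LMlt Q \<and> x \<in> carrier Q \<and> y \<in> carrier Q}"
      using xy by blast
  qed (use gS L in \<open>auto simp: LMlt_Sym\<close>)
qed

lemma left_trans_LMlt_pow_eq_one:
  assumes "v \<in> carrier Q"
    and "left_trans Q v [^]\<^bsub>Sym\<^esub> (n::nat) = \<one>\<^bsub>Sym\<^esub>" "g \<in> LMlt Q"
  shows "left_trans Q (g v) [^]\<^bsub>Sym\<^esub> n = \<one>\<^bsub>Sym\<^esub>"
proof -
  interpret S: group Sym by (rule group_BijGroup)
  have gS: "g \<in> carrier Sym" using LMlt_Sym assms by blast
  have L: "left_trans Q v \<in> carrier Sym" "left_trans Q (g v) \<in> carrier Sym"
    using left_trans_Sym [of "{v, g v}"] assms Sym_closed [OF gS] by auto
  have "g \<otimes>\<^bsub>Sym\<^esub> left_trans Q v [^]\<^bsub>Sym\<^esub> n = left_trans Q (g v) [^]\<^bsub>Sym\<^esub> n \<otimes>\<^bsub>Sym\<^esub> g"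
  proof (induction n)
    case (Suc n)
    have "g \<otimes>\<^bsub>Sym\<^esub> left_trans Q v [^]\<^bsub>Sym\<^esub> Suc n
        = left_trans Q (g v) [^]\<^bsub>Sym\<^esub> n \<otimes>\<^bsub>Sym\<^esub> (g \<otimes>\<^bsub>Sym\<^esub> left_trans Q v)"
      using Suc gS L by (simp add: S.m_assoc [symmetric])
    then show ?case
      using gS L LMlt_left_trans [of g v] assms by (simp add: S.m_assoc [symmetric])
  qed (use gS in simp)
  then show ?thesis using gS L assms(2) by simp
qed

text \<open>The conjugating permutation must lie in the group generated by the \<open>L\<^sub>t\<close> with \<open>t \<in> T\<close>, since only
  these are available inside a subalgebra. Therefore the coprimality theorem is applied to the
  intersection of that group with \<open>Dis(Q)\<close> rather than to \<open>Dis(Q)\<close> itself.\<close>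

lemma coprime_left_trans_conjugate:
  assumes T: "T \<subseteq> carrier Q" and yz: "y \<in> T" "z \<in> T"
    and n: "0 < n" "left_trans Q y [^]\<^bsub>Sym\<^esub> (n::nat) = \<one>\<^bsub>Sym\<^esub>" "left_trans Q z [^]\<^bsub>Sym\<^esub> n = \<one>\<^bsub>Sym\<^esub>"
    and fin: "finite (Dis Q)" and coprime: "coprime n (card (Dis Q))"
  shows "\<exists>g\<in>generate Sym (left_trans Q ` T). left_trans Q (g y) = left_trans Q z"
proof -
  interpret S: group Sym by (rule group_BijGroup)
  define H where "H = generate Sym (left_trans Q ` T)"
  define K where "K = H \<inter> Dis Q"
  have H: "subgroup H Sym"
    unfolding H_def by (rule S.generate_is_subgroup [OF left_trans_Sym [OF T]])
  interpret H: subgroup H Sym by fact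
  have HL: "H \<subseteq> LMlt Q"
    unfolding H_def LMlt_def using T by (intro S.mono_generate image_mono)
  have K: "subgroup K Sym" unfolding K_def by (rule S.subgroups_Inter_pair [OF H Dis_subgroup])
  let ?a = "left_trans Q y" and ?b = "left_trans Q z"
  have abH: "?a \<in> H" "?b \<in> H" using yz by (auto simp: H_def generate.incl)
  have "card K dvd card (Dis Q)"
    using K Dis_subgroup by (rule S.card_subgroup_dvd) (auto simp: K_def)
  then have cop: "coprime n (card K)" using coprime by (meson coprime_divisors dvd_refl)
  \<comment> \<open>\<open>?a\<close> normalizes \<open>K\<close> and \<open>?b\<close> lies in the coset \<open>K ?a\<close>.\<close>
  have twist: "?b \<otimes>\<^bsub>Sym\<^esub> k \<otimes>\<^bsub>Sym\<^esub> inv\<^bsub>Sym\<^esub> ?a \<in> K" if k: "k \<in> K" for k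
  proof -
    have kH: "k \<in> H" "k \<in> Dis Q" using k by (auto simp: K_def)
    have "?b \<otimes>\<^bsub>Sym\<^esub> k \<otimes>\<^bsub>Sym\<^esub> inv\<^bsub>Sym\<^esub> ?a =
        (?b \<otimes>\<^bsub>Sym\<^esub> inv\<^bsub>Sym\<^esub> ?a) \<otimes>\<^bsub>Sym\<^esub> (?a \<otimes>\<^bsub>Sym\<^esub> k \<otimes>\<^bsub>Sym\<^esub> inv\<^bsub>Sym\<^esub> ?a)"
      using kH abH by (simp add: S.m_assoc S.inv_solve_left)
    moreover have "?b \<otimes>\<^bsub>Sym\<^esub> inv\<^bsub>Sym\<^esub> ?a \<in> Dis Q"
      using yz T by (intro left_trans_quotient_Dis) auto
    moreover have "?a \<otimes>\<^bsub>Sym\<^esub> k \<otimes>\<^bsub>Sym\<^esub> inv\<^bsub>Sym\<^esub> ?a \<in> Dis Q"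
      using kH abH HL by (intro Dis_conj_closed) auto
    ultimately have "?b \<otimes>\<^bsub>Sym\<^esub> k \<otimes>\<^bsub>Sym\<^esub> inv\<^bsub>Sym\<^esub> ?a \<in> Dis Q"
      using subgroup.m_closed [OF Dis_subgroup] by simp
    then show ?thesis using kH abH by (simp add: K_def)
  qed
  have "finite K" using fin by (simp add: K_def)
  then obtain k where k: "k \<in> K" "?b \<otimes>\<^bsub>Sym\<^esub> k = k \<otimes>\<^bsub>Sym\<^esub> ?a"
    using S.coprime_exponent_intertwiner [OF K _ _ _ n(1) cop n(2,3) twist] abH by auto
  have kH: "k \<in> H" using k by (simp add: K_def)
  have y: "y \<in> carrier Q" using yz T by auto
  have "left_trans Q (k y) \<in> carrier Sym"
    using left_trans_Sym [of "{k y}"] Sym_closed [OF _ y] kH by auto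
  moreover have "left_trans Q (k y) \<otimes>\<^bsub>Sym\<^esub> k = ?b \<otimes>\<^bsub>Sym\<^esub> k"
    using k(2) LMlt_left_trans [of k y] kH HL y by auto
  ultimately have "left_trans Q (k y) = ?b"
    using kH abH by simp
  then show ?thesis using kH by (auto simp: H_def)
qed

section \<open>Subalgebras of the quotient by the Cayley kernel\<close>

abbreviation cls :: "'a \<Rightarrow> 'a set" where
  "cls y \<equiv> cayley_kernel Q `` {y}"

abbreviation Qbar :: "'a set quandle" where
  "Qbar \<equiv> quot_quandle Q (cayley_kernel Q)"

lemma carrier_Qbar: "carrier Qbar = cls ` carrier Q"
  by (auto simp: quot_quandle_def quotient_def)

lemma cls_eq_iff:
  assumes "u \<in> carrier Q" "v \<in> carrier Q"
  shows "cls u = cls v \<longleftrightarrow> left_trans Q u = left_trans Q v"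
  using assms eq_equiv_class_iff [OF equiv_cayley_kernel, of u v] by (simp add: cayley_kernel_def)

text \<open>The permutation \<open>g\<close> acts on all of \<open>Q\<close>, while the orbit is formed by permutations of \<open>S\<close> only.
  No homomorphism between the two groups is needed: the preimage in
  \<open>Q\<close> of the orbit is stable under the generators and their inverses.\<close>

lemma cls_generate_left_trans_orbit:
  assumes S: "subalgebra_of S Qbar"
    and g: "g \<in> generate Sym (left_trans Q ` {s \<in> carrier Q. cls s \<in> S})"
    and y: "y \<in> carrier Q" "cls y \<in> S"
  shows "cls (g y) \<in> quandle_orbit (Qbar\<lparr>carrier := S\<rparr>) (cls y)"
proof -
  interpret P: quandle Qbar by (rule quandle_quot)
  interpret PS: quandle "Qbar\<lparr>carrier := S\<rparr>" by (rule P.quandle_subalgebra [OF S])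
  let ?O = "quandle_orbit (Qbar\<lparr>carrier := S\<rparr>) (cls y)"
  have sub: "subalgebra_of ?O (Qbar\<lparr>carrier := S\<rparr>)" "cls y \<in> ?O"
    using PS.subalgebra_orbit [of "cls y"] y by auto
  have "s \<star> u \<in> {u \<in> carrier Q. cls u \<in> ?O} \<and> s \<setminus> u \<in> {u \<in> carrier Q. cls u \<in> ?O}"
    if s: "s \<in> {s \<in> carrier Q. cls s \<in> S}" and u: "u \<in> {u \<in> carrier Q. cls u \<in> ?O}" for s u
  proof -
    obtain h where h: "h \<in> LMlt (Qbar\<lparr>carrier := S\<rparr>)" "cls u = h (cls y)"
      using u by (auto simp: quandle_orbit_def)
    have "\<exists>k\<in>LMlt (Qbar\<lparr>carrier := S\<rparr>). k (cls y) = cls s \<star>\<^bsub>Qbar\<^esub> cls u"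
      "\<exists>k\<in>LMlt (Qbar\<lparr>carrier := S\<rparr>). k (cls y) = cls s \<setminus>\<^bsub>Qbar\<^esub> cls u"
      using PS.left_trans_LMlt [of "cls s" h "cls y"] h s y by auto
    then have "cls s \<star>\<^bsub>Qbar\<^esub> cls u \<in> ?O" "cls s \<setminus>\<^bsub>Qbar\<^esub> cls u \<in> ?O"
      by (simp_all add: quandle_orbit_iff)
    then show ?thesis using s u by (simp add: quot_star quot_ldiv)
  qed
  then have "g y \<in> {u \<in> carrier Q. cls u \<in> ?O}"
    using y sub(2) by (intro generate_left_trans_invariant [OF _ g]) auto
  then show ?thesis by simp
qed

text \<open>The image of the orbit of \<open>x\<close> contains the class of \<open>x\<close> and is closed under translations of the
  quotient and their inverses. So every class in the orbit has a representative in the orbit of \<open>x\<close>, whose translation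
  is conjugate to \<open>L\<^sub>x\<close>.\<close>

lemma cls_orbit_subset:
  assumes x: "x \<in> carrier Q"
  shows "quandle_orbit Qbar (cls x) \<subseteq> cls ` quandle_orbit Q x"
proof
  fix z assume z: "z \<in> quandle_orbit Qbar (cls x)"
  interpret P: quandle Qbar by (rule quandle_quot)
  obtain h where h: "h \<in> LMlt Qbar" "z = h (cls x)" using z by (auto simp: quandle_orbit_def)
  have O: "quandle_orbit Q x \<subseteq> carrier Q" "x \<in> quandle_orbit Q x"
    using subalgebra_orbit [OF x] by (auto simp: subalgebra_of_def)
  have closed: "s \<star>\<^bsub>Qbar\<^esub> u \<in> cls ` quandle_orbit Q x \<and> s \<setminus>\<^bsub>Qbar\<^esub> u \<in> cls ` quandle_orbit Q x"
    if su: "s \<in> carrier Qbar" "u \<in> cls ` quandle_orbit Q x" for s u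
  proof -
    obtain t where t: "t \<in> carrier Q" "s = cls t" using su(1) carrier_Qbar by blast
    obtain k where k: "k \<in> LMlt Q" "u = cls (k x)" using su(2) by (auto simp: quandle_orbit_def)
    have "t \<star> k x \<in> quandle_orbit Q x" "t \<setminus> k x \<in> quandle_orbit Q x"
      using left_trans_LMlt [OF t(1) k(1) x] by (simp_all add: quandle_orbit_iff)
    moreover have "k x \<in> carrier Q" using Sym_closed [OF LMlt_Sym [OF k(1)] x] .
    ultimately show ?thesis using t k by (auto simp: quot_star quot_ldiv)
  qed
  have "cls ` quandle_orbit Q x \<subseteq> carrier Qbar"
    unfolding carrier_Qbar using O(1) by (rule image_mono)
  then show "z \<in> cls ` quandle_orbit Q x"
    unfolding h(2)
    by (rule P.generate_left_trans_invariant [OF subset_refl h(1) [unfolded LMlt_def]])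
      (use closed O(2) in blast)+
qed

lemma connected_subalgebra_of_quotient_orbit:
  assumes x: "x \<in> carrier Q"
    and n: "0 < n" "left_trans Q x [^]\<^bsub>Sym\<^esub> (n::nat) = \<one>\<^bsub>Sym\<^esub>"
    and fin: "finite (Dis Q)" and coprime: "coprime n (card (Dis Q))"
    and S: "subalgebra_of S Qbar" "S \<subseteq> quandle_orbit Qbar (cls x)"
  shows "connected_quandle (Qbar\<lparr>carrier := S\<rparr>)"
  unfolding connected_quandle_def
proof (intro ballI)
  have rep: "\<exists>y\<in>carrier Q. A = cls y \<and> left_trans Q y [^]\<^bsub>Sym\<^esub> n = \<one>\<^bsub>Sym\<^esub>" if A: "A \<in> S" for A
  proof -
    obtain g where g: "g \<in> LMlt Q" "A = cls (g x)"
      using subsetD [OF cls_orbit_subset [OF x] subsetD [OF S(2) A]] unfolding quandle_orbit_def by blast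
    show ?thesis
      using left_trans_LMlt_pow_eq_one [OF x n(2) g(1)] Sym_closed [OF LMlt_Sym [OF g(1)] x] g(2)
      by (intro bexI [of _ "g x"] conjI)
  qed
  fix A B assume "A \<in> carrier (Qbar\<lparr>carrier := S\<rparr>)" "B \<in> carrier (Qbar\<lparr>carrier := S\<rparr>)"
  then have AB: "A \<in> S" "B \<in> S" by auto
  obtain y where y: "y \<in> carrier Q" "A = cls y" "left_trans Q y [^]\<^bsub>Sym\<^esub> n = \<one>\<^bsub>Sym\<^esub>"
    using rep [OF AB(1)] by blast
  obtain z where z: "z \<in> carrier Q" "B = cls z" "left_trans Q z [^]\<^bsub>Sym\<^esub> n = \<one>\<^bsub>Sym\<^esub>"
    using rep [OF AB(2)] by blast
  let ?T = "{s \<in> carrier Q. cls s \<in> S}"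
  obtain g where g: "g \<in> generate Sym (left_trans Q ` ?T)" "left_trans Q (g y) = left_trans Q z"
    using coprime_left_trans_conjugate [of ?T y z n] y z AB n fin coprime by auto
  have "g \<in> carrier Sym" using generate_left_trans_Sym [of ?T] g by auto
  then have "cls (g y) = B" using g y z cls_eq_iff Sym_closed by simp
  then have "B \<in> quandle_orbit (Qbar\<lparr>carrier := S\<rparr>) A"
    using cls_generate_left_trans_orbit [OF S(1) g(1)] y AB by auto
  then show "\<exists>h\<in>LMlt (Qbar\<lparr>carrier := S\<rparr>). h A = B" by (auto simp: quandle_orbit_def)
qed

lemma quotient_orbit_of_connected:
  assumes x: "x \<in> carrier Q" and conn: "connected_quandle Q"
  shows "quandle_orbit Qbar (cls x) = carrier Qbar"
proof
  interpret P: quandle Qbar by (rule quandle_quot)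
  have cx: "cls x \<in> carrier Qbar" using x by (simp add: carrier_Qbar)
  show "quandle_orbit Qbar (cls x) \<subseteq> carrier Qbar"
    using P.subalgebra_orbit [OF cx] by (auto simp: subalgebra_of_def)
  have whole: "subalgebra_of (carrier Qbar) Qbar"
    using cx by (auto simp: subalgebra_of_def)
  have "cls y \<in> quandle_orbit Qbar (cls x)" if y: "y \<in> carrier Q" for y
  proof -
    obtain h where h: "h \<in> LMlt Q" "h x = y" using conn x y by (auto simp: connected_quandle_def)
    have "{s \<in> carrier Q. cls s \<in> carrier Qbar} = carrier Q" by (auto simp: carrier_Qbar)
    then show ?thesis
      using cls_generate_left_trans_orbit [OF whole _ x cx, of h] h by (simp add: LMlt_def)
  qed
  then show "carrier Qbar \<subseteq> quandle_orbit Qbar (cls x)" by (auto simp: carrier_Qbar)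
qed

end

theorem proposition3p9:
  fixes Q :: "('a, 'b) quandle_scheme" and x :: 'a
  assumes "quandle Q"
    and "x \<in> carrier Q"
    and "group.ord (BijGroup (carrier Q)) (left_trans Q x) \<noteq> 0"  \<comment> \<open>\<open>ord\<close> is 0 for infinite order\<close>
    and "finite (Dis Q)"
    and "coprime (group.ord (BijGroup (carrier Q)) (left_trans Q x)) (card (Dis Q))"
  shows "superconnected_quandle
           ((quot_quandle Q (cayley_kernel Q))
             \<lparr>carrier := quandle_orbit (quot_quandle Q (cayley_kernel Q)) (cayley_kernel Q `` {x})\<rparr>)
       \<and> (connected_quandle Q \<longrightarrow> superconnected_quandle (quot_quandle Q (cayley_kernel Q)))"
proof -
  interpret quandle Q by fact
  interpret P: quandle Qbar by (rule quandle_quot)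
  interpret S: group Sym by (rule group_BijGroup)
  define n where "n = S.ord (left_trans Q x)"
  have "left_trans Q x \<in> carrier Sym" using left_trans_Sym [of "{x}"] assms(2) by simp
  then have n: "0 < n" "left_trans Q x [^]\<^bsub>Sym\<^esub> n = \<one>\<^bsub>Sym\<^esub>" "coprime n (card (Dis Q))"
    using assms(3,5) by (auto simp: n_def)
  let ?O = "quandle_orbit Qbar (cls x)"
  have "?O \<subseteq> carrier Qbar"
    using P.subalgebra_orbit [of "cls x"] assms(2) by (auto simp: subalgebra_of_def carrier_Qbar)
  then have "subalgebra_of S Qbar" "S \<subseteq> ?O" if "subalgebra_of S (Qbar\<lparr>carrier := ?O\<rparr>)" for S
    using that by (auto simp: subalgebra_of_def)
  then have i: "superconnected_quandle (Qbar\<lparr>carrier := ?O\<rparr>)"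
    using connected_subalgebra_of_quotient_orbit [OF assms(2) n(1,2) assms(4) n(3)]
    by (simp add: superconnected_quandle_def)
  have "Qbar\<lparr>carrier := ?O\<rparr> = Qbar" if "connected_quandle Q"
    using quotient_orbit_of_connected [OF assms(2) that] by simp
  with i show ?thesis by auto
qed

end
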